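(* Let $\mathcal{T}$ be a random dynamical system on $X$ over $(\Omega,\mathcal{B}(\Omega),\mathbb{P},\vartheta)$ with a stationary measure $\mu$. Then for $\mathbb{P}\otimes\mu$-almost every $(\omega,x)\in\Omega\times X$ \[\underline{R}^{\omega}(x)\leq\underline{d}_\mu(x)\qquad\text{and}\qquad\overline{R}^{\omega}(x)\leq\overline{d}_\mu(x).\]
   Context: Random dynamical system: $\Omega$ is a metric space with Borel $\sigma$-algebra $\mathcal{B}(\Omega)$, $\mathbb{P}$ is a probability measure on $(\Omega,\mathcal{B}(\Omega))$, and $\vartheta:\Omega\to\Omega$ is a measurable $\mathbb{P}$-preserving map. $X$ is a compact Riemannian manifold with distance $d$, and $B(x,r)$ denotes the open ball. A family of maps $T_\omega:X\to X$, $\omega\in\Omega$, is given such that $(\omega,x)\mapsto T_\omega x$ is measurable. For $n\ge 1$ set $T^n_\omega:=T_{\vartheta^{n-1}\omega}\circ\cdots\circ T_{\vartheta\omega}\circ T_\omega$ (and $T^0_\omega=\mathrm{id}$), so that $T^{n+m}_\omega=T^n_{\vartheta^m\omega}\circ T^m_\omega$. These data form the random dynamical system $\mathcal{T}$ on $X$ over $(\Omega,\mathcal{B}(\Omega),\mathbb{P},\vartheta)$. Stationary measure: the skew product is $S:\Omega\times X\to\Omega\times X$, $S(\omega,x)=(\vartheta\omega,T_\omega x)$. A Borel probability measure $\mu$ on $X$ is stationary if $\mathbb{P}\otimes\mu$ is $S$-invariant. Non-instantaneous quenched return times and recurrence rates: for $r>0$, $p\in\mathbb{N}=\{0,1,2,\dots\}$,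 \[\tau^{\omega}_{r,p}(x):=\inf\{k>p: d(T^k_\omega x,x)<r\}\] (with $\inf\emptyset=+\infty$, $\log(+\infty)=+\infty$), and \[\underline{R}^{\omega}(x):=\lim_{p\to\infty}\liminf_{r\to0}\frac{\log\tau_{r,p}^{\omega}(x)}{-\log r},\qquad \overline{R}^{\omega}(x):=\lim_{p\to\infty}\limsup_{r\to0}\frac{\log\tau_{r,p}^{\omega}(x)}{-\log r}.\] Local dimensions: $\underline{d}_\mu(x)=\liminf_{r\to0}\frac{\log\mu(B(x,r))}{\log r}$ and $\overline{d}_\mu(x)=\limsup_{r\to0}\frac{\log\mu(B(x,r))}{\log r}$. *)

theory Defs
  imports "HOL-Probability.Probability"
begin

section \<open>Riemannian manifolds\<close>

text \<open>For open \<open>S\<close> this is the class \<open>C^k\<close>: existence and continuity of all iterated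
  directional derivatives of order at most \<open>k\<close>.\<close>

primrec Ck_on :: "nat \<Rightarrow> 'a::euclidean_space set \<Rightarrow> ('a \<Rightarrow> 'b::real_normed_vector) \<Rightarrow> bool" where
  "Ck_on 0 S f \<longleftrightarrow> continuous_on S f"
| "Ck_on (Suc k) S f \<longleftrightarrow>
     (\<forall>y\<in>S. f differentiable (at y)) \<and>
     (\<forall>v. Ck_on k S (\<lambda>y. frechet_derivative f (at y) v))"

definition smooth_on :: "'a::euclidean_space set \<Rightarrow> ('a \<Rightarrow> 'b::real_normed_vector) \<Rightarrow> bool" where
  "smooth_on S f \<longleftrightarrow> (\<forall>k. Ck_on k S f)"

type_synonym ('x, 'e) chart = "'x set \<times> ('x \<Rightarrow> 'e)"

definition smooth_atlas :: "('x::topological_space, 'e::euclidean_space) chart set \<Rightarrow> bool" where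
  "smooth_atlas A \<longleftrightarrow>
     (\<Union>(U, \<phi>)\<in>A. U) = UNIV \<and>
     (\<forall>(U, \<phi>)\<in>A. open U \<and> open (\<phi> ` U) \<and> homeomorphism U (\<phi> ` U) \<phi> (inv_into U \<phi>)) \<and>
     (\<forall>(U, \<phi>)\<in>A. \<forall>(V, \<psi>)\<in>A. smooth_on (\<phi> ` (U \<inter> V)) (\<psi> \<circ> inv_into U \<phi>))"

text \<open>\<open>g (U, \<phi>) x\<close> is the inner product on the tangent space at \<open>x \<in> U\<close>, expressed in the
  coordinates given by \<open>\<phi>\<close>. The last clause says that the local expressions define one tensor.\<close>

definition riemannian_metric ::
  "('x::topological_space, 'e::euclidean_space) chart set \<Rightarrow>
   (('x, 'e) chart \<Rightarrow> 'x \<Rightarrow> 'e \<Rightarrow> 'e \<Rightarrow> real) \<Rightarrow> bool" where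
  "riemannian_metric A g \<longleftrightarrow>
     (\<forall>(U, \<phi>)\<in>A.
        (\<forall>x\<in>U. bilinear (g (U, \<phi>) x) \<and>
               (\<forall>u v. g (U, \<phi>) x u v = g (U, \<phi>) x v u) \<and>
               (\<forall>u. u \<noteq> 0 \<longrightarrow> g (U, \<phi>) x u u > 0)) \<and>
        (\<forall>u v. smooth_on (\<phi> ` U) (\<lambda>y. g (U, \<phi>) (inv_into U \<phi> y) u v))) \<and>
     (\<forall>(U, \<phi>)\<in>A. \<forall>(V, \<psi>)\<in>A. \<forall>x\<in>U \<inter> V. \<forall>u v.
        let D = frechet_derivative (\<psi> \<circ> inv_into U \<phi>) (at (\<phi> x))
        in g (U, \<phi>) x u v = g (V, \<psi>) x (D u) (D v))"

definition C1_curve_on ::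
  "('x::topological_space, 'e::euclidean_space) chart set \<Rightarrow> real \<Rightarrow> real \<Rightarrow> (real \<Rightarrow> 'x) \<Rightarrow> bool" where
  "C1_curve_on A a b \<gamma> \<longleftrightarrow>
     continuous_on {a..b} \<gamma> \<and>
     (\<forall>(U, \<phi>)\<in>A. \<exists>\<gamma>'. continuous_on {t\<in>{a..b}. \<gamma> t \<in> U} \<gamma>' \<and>
        (\<forall>t\<in>{a..b}. \<gamma> t \<in> U \<longrightarrow>
           ((\<phi> \<circ> \<gamma>) has_vector_derivative \<gamma>' t) (at t within {a..b})))"

definition piecewise_C1_curve ::
  "('x::topological_space, 'e::euclidean_space) chart set \<Rightarrow> (real \<Rightarrow> 'x) \<Rightarrow> bool" where
  "piecewise_C1_curve A \<gamma> \<longleftrightarrow>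
     (\<exists>(n::nat) (s::nat \<Rightarrow> real). s 0 = 0 \<and> s n = 1 \<and>
        (\<forall>i<n. s i < s (Suc i) \<and> C1_curve_on A (s i) (s (Suc i)) \<gamma>))"

text \<open>By the transformation rule for \<open>g\<close>, the speed does not depend on the chart chosen.\<close>

definition curve_speed ::
  "('x::topological_space, 'e::euclidean_space) chart set \<Rightarrow>
   (('x, 'e) chart \<Rightarrow> 'x \<Rightarrow> 'e \<Rightarrow> 'e \<Rightarrow> real) \<Rightarrow> (real \<Rightarrow> 'x) \<Rightarrow> real \<Rightarrow> real" where
  "curve_speed A g \<gamma> t =
     (let c = (SOME c. c \<in> A \<and> \<gamma> t \<in> fst c);
          v = vector_derivative (snd c \<circ> \<gamma>) (at t)
      in sqrt (g c (\<gamma> t) v v))"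

definition curve_length ::
  "('x::topological_space, 'e::euclidean_space) chart set \<Rightarrow>
   (('x, 'e) chart \<Rightarrow> 'x \<Rightarrow> 'e \<Rightarrow> 'e \<Rightarrow> real) \<Rightarrow> (real \<Rightarrow> 'x) \<Rightarrow> real" where
  "curve_length A g \<gamma> = integral {0..1} (curve_speed A g \<gamma>)"

text \<open>The topology of the manifold is the one of the metric space, and \<open>dist\<close> is the geodesic
  distance. If the manifold is connected, any two points are joined by a piecewise \<open>C^1\<close> curve.
  If it is not, the geodesic distance between two components would be infinite; there, \<open>dist\<close> is
  only required to give the manifold topology.\<close>

definition riemannian_manifold ::
  "('x::metric_space, 'e::euclidean_space) chart set \<Rightarrow>
   (('x, 'e) chart \<Rightarrow> 'x \<Rightarrow> 'e \<Rightarrow> 'e \<Rightarrow> real) \<Rightarrow> bool" where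
  "riemannian_manifold A g \<longleftrightarrow>
     smooth_atlas A \<and> riemannian_metric A g \<and>
     (\<forall>x y. let \<Gamma> = {\<gamma>. piecewise_C1_curve A \<gamma> \<and> \<gamma> 0 = x \<and> \<gamma> 1 = y}
            in \<Gamma> \<noteq> {} \<longrightarrow> dist x y = Inf (curve_length A g ` \<Gamma>))"

section \<open>Random dynamical systems\<close>

definition random_dynamical_system ::
  "'w::metric_space measure \<Rightarrow> ('w \<Rightarrow> 'w) \<Rightarrow> ('w \<Rightarrow> 'x::metric_space \<Rightarrow> 'x) \<Rightarrow> bool" where
  "random_dynamical_system P \<theta> T \<longleftrightarrow>
     prob_space P \<and> sets P = sets borel \<and>
     \<theta> \<in> P \<rightarrow>\<^sub>M P \<and> distr P P \<theta> = P \<and>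
     (\<lambda>(\<omega>, x). T \<omega> x) \<in> borel \<Otimes>\<^sub>M borel \<rightarrow>\<^sub>M borel"

primrec rds_iter :: "('w \<Rightarrow> 'w) \<Rightarrow> ('w \<Rightarrow> 'x \<Rightarrow> 'x) \<Rightarrow> nat \<Rightarrow> 'w \<Rightarrow> 'x \<Rightarrow> 'x" where
  "rds_iter \<theta> T 0 \<omega> = id"
| "rds_iter \<theta> T (Suc n) \<omega> = T ((\<theta> ^^ n) \<omega>) \<circ> rds_iter \<theta> T n \<omega>"

definition skew_product :: "('w \<Rightarrow> 'w) \<Rightarrow> ('w \<Rightarrow> 'x \<Rightarrow> 'x) \<Rightarrow> 'w \<times> 'x \<Rightarrow> 'w \<times> 'x" where
  "skew_product \<theta> T = (\<lambda>(\<omega>, x). (\<theta> \<omega>, T \<omega> x))"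

definition stationary_measure ::
  "'w measure \<Rightarrow> ('w \<Rightarrow> 'w) \<Rightarrow> ('w \<Rightarrow> 'x::metric_space \<Rightarrow> 'x) \<Rightarrow> 'x measure \<Rightarrow> bool" where
  "stationary_measure P \<theta> T \<mu> \<longleftrightarrow>
     prob_space \<mu> \<and> sets \<mu> = sets borel \<and>
     distr (P \<Otimes>\<^sub>M \<mu>) (P \<Otimes>\<^sub>M \<mu>) (skew_product \<theta> T) = P \<Otimes>\<^sub>M \<mu>"

section \<open>Recurrence rates and local dimensions\<close>

text \<open>The logarithm on \<open>[0, \<infinity>]\<close>, with \<open>log 0 = -\<infinity>\<close> (whereas \<^term>\<open>ln 0 = (0::real)\<close>)
  and \<open>log \<infinity> = \<infinity>\<close>.\<close>

definition elog :: "ereal \<Rightarrow> ereal" where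
  "elog t = (if t \<le> 0 then -\<infinity> else if t = \<infinity> then \<infinity> else ereal (ln (real_of_ereal t)))"

definition return_time ::
  "('w \<Rightarrow> 'w) \<Rightarrow> ('w \<Rightarrow> 'x::metric_space \<Rightarrow> 'x) \<Rightarrow> real \<Rightarrow> nat \<Rightarrow> 'w \<Rightarrow> 'x \<Rightarrow> enat" where
  "return_time \<theta> T r p \<omega> x = Inf {enat k |k. k > p \<and> dist (rds_iter \<theta> T k \<omega> x) x < r}"

definition lower_recurrence_rate ::
  "('w \<Rightarrow> 'w) \<Rightarrow> ('w \<Rightarrow> 'x::metric_space \<Rightarrow> 'x) \<Rightarrow> 'w \<Rightarrow> 'x \<Rightarrow> ereal" where
  "lower_recurrence_rate \<theta> T \<omega> x =
     lim (\<lambda>p. Liminf (at_right 0)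
       (\<lambda>r. elog (ereal_of_enat (return_time \<theta> T r p \<omega> x)) / ereal (- ln r)))"

definition upper_recurrence_rate ::
  "('w \<Rightarrow> 'w) \<Rightarrow> ('w \<Rightarrow> 'x::metric_space \<Rightarrow> 'x) \<Rightarrow> 'w \<Rightarrow> 'x \<Rightarrow> ereal" where
  "upper_recurrence_rate \<theta> T \<omega> x =
     lim (\<lambda>p. Limsup (at_right 0)
       (\<lambda>r. elog (ereal_of_enat (return_time \<theta> T r p \<omega> x)) / ereal (- ln r)))"

definition lower_local_dim :: "'x::metric_space measure \<Rightarrow> 'x \<Rightarrow> ereal" where
  "lower_local_dim \<mu> x =
     Liminf (at_right 0) (\<lambda>r. elog (ereal (measure \<mu> (ball x r))) / ereal (ln r))"

definition upper_local_dim :: "'x::metric_space measure \<Rightarrow> 'x \<Rightarrow> ereal" where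
  "upper_local_dim \<mu> x =
     Limsup (at_right 0) (\<lambda>r. elog (ereal (measure \<mu> (ball x r))) / ereal (ln r))"

end

theory Submission
  imports Defs "HOL-Real_Asymp.Real_Asymp"
begin

text \<open>
  A set \<open>Q\<close> of diameter less than \<open>r\<close> turns returns to \<open>Q\<close> into \<open>r\<close>-close returns. By a
  finite form of Kac's lemma (\<open>measure_no_return_le\<close>), the points of \<open>\<Omega> \<times> Q\<close> that do not come
  back to it within \<open>L\<close> iterates of a measure preserving map have measure at most \<open>1 / (L + 1)\<close>.
  With \<open>L\<close> about \<open>K / \<mu>(Q)\<close> this is at most \<open>\<mu>(Q) / K\<close>, so over a disjoint family of sets \<open>Q\<close>
  the exceptional measures add up to at most \<open>1 / K\<close>. Applying this to the power \<open>S^(p+1)\<close> of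
  the skew product gives returns at times beyond \<open>p\<close>, at the cost of a factor \<open>p + 1\<close> only.

  The resulting bound \<open>(p + 1) K / \<mu>(Q)\<close> must be compared with the mass of a ball around the
  point, so most points should lie in some \<open>Q\<close> together with a whole ball \<open>B(x, t)\<close>, where \<open>t\<close> is
  hardly smaller than \<open>r\<close>. Such a family comes from growing balls
  (\<open>padded_family_within\<close>). Start at a point whose \<open>t\<close>-ball has mass at least \<open>m\<close> and enlarge
  the radius in steps of \<open>2 t\<close>. As the mass cannot exceed 1, one of the first
  \<open>log (1 / m) / log (1 + \<delta>)\<close> steps increases it by a factor at most \<open>1 + \<delta>\<close>. Stopping there, the
  points close to the boundary have measure at most \<open>\<delta>\<close> times that of the enclosed set. Remove
  the set and repeat.

  At the scales \<open>r = 2^(-n)\<close> take \<open>K = (n + 1)^2\<close>, \<open>\<delta> = 1 / K\<close> and \<open>m = 2 / 2^K\<close>. The exceptional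
  sets then have summable measure, so by Borel--Cantelli almost every point eventually satisfies
  \<open>\<tau> \<le> (p + 1) K / \<mu>(B(x, t))\<close> whenever \<open>\<mu>(B(x, t)) \<ge> m\<close>. The number of growth steps is
  polynomial in \<open>n\<close>, so \<open>log t / log r \<longrightarrow> 1\<close>, and \<open>K\<close> disappears after taking logarithms and
  dividing by \<open>n\<close>. The mass condition costs nothing either: an infinite
  local dimension bounds anything, and a finite one means that
  the ball has mass at least a power of \<open>2^(-n)\<close> at the relevant scales, while \<open>m\<close> decays faster
  than any such power. This gives both inequalities for each fixed \<open>p\<close>; the quotients increase
  with \<open>p\<close>, so the bounds pass to the limit.
\<close>

section \<open>Disjoint families of small sets with padding\<close>

lemma slow_growth_step:
  fixes a :: "nat \<Rightarrow> real"
  assumes "0 \<le> \<delta>" "m \<le> a 0" "a N \<le> 1" "1 < m * (1 + \<delta>) ^ N"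
  shows "\<exists>k<N. a (Suc k) \<le> (1 + \<delta>) * a k"
proof (rule ccontr)
  assume "\<not> ?thesis"
  then have step: "(1 + \<delta>) * a k < a (Suc k)" if "k < N" for k
    using that by (meson not_le)
  have "k \<le> N \<Longrightarrow> m * (1 + \<delta>) ^ k \<le> a k" for k
  proof (induction k)
    case (Suc k)
    then have "(1 + \<delta>) * (m * (1 + \<delta>) ^ k) \<le> (1 + \<delta>) * a k"
      using assms(1) by (intro mult_left_mono) auto
    also have "\<dots> \<le> a (Suc k)" using step[of k] Suc.prems by simp
    finally show ?case by (simp add: algebra_simps)
  qed (use assms in simp)
  from this[of N] assms show False by simp
qed

text \<open>
  The iteration removes one grown set \<open>Q\<close> at a time. The next centre must have its whole
  \<open>t\<close>-ball inside what remains of \<open>X\<close>. This is why the statement is relative to \<open>X\<close> and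
  only speaks of points \<open>z\<close> with \<open>ball z t \<subseteq> X\<close>: growth then starts from mass at least
  \<open>m\<close> inside \<open>X\<close>, and each removal uses up mass \<open>m\<close>, which bounds the number of rounds by \<open>n\<close>.
\<close>

lemma padded_family_within:
  fixes \<mu> :: "'x::metric_space measure"
  assumes "prob_space \<mu>" and sets: "sets \<mu> = sets borel"
    and pos: "0 \<le> \<delta>" "0 < t" "0 < m"
    and N: "1 < m * (1 + \<delta>) ^ N"
    and X: "X \<in> sets borel" "measure \<mu> X < real n * m"
  shows "\<exists>\<Q> E. finite \<Q> \<and> \<Q> \<subseteq> sets borel \<and> disjoint \<Q> \<and> \<Union>\<Q> \<subseteq> X \<and>
           (\<forall>Q\<in>\<Q>. \<forall>u\<in>Q. \<forall>v\<in>Q. dist u v < 4 * real N * t) \<and>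
           E \<in> sets borel \<and> measure \<mu> E \<le> \<delta> * measure \<mu> (\<Union>\<Q>) \<and>
           (\<forall>z. ball z t \<subseteq> X \<longrightarrow> m \<le> measure \<mu> (ball z t) \<longrightarrow>
              z \<in> E \<or> (\<exists>Q\<in>\<Q>. ball z t \<subseteq> Q))"
  using X
proof (induction n arbitrary: X)
  case 0
  then show ?case using measure_nonneg[of \<mu> X] by simp
next
  case (Suc n)
  interpret prob_space \<mu> by fact
  note [measurable_cong] = sets
  note [measurable] = Suc.prems(1)
  show ?case
  proof (cases "\<exists>y. ball y t \<subseteq> X \<and> m \<le> measure \<mu> (ball y t)")
    case False
    then show ?thesis by (intro exI[of _ "{}"]) auto
  next
    case True
    then obtain y where y: "ball y t \<subseteq> X" "m \<le> measure \<mu> (ball y t)" by blast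
    \<comment> \<open>Steps of size \<open>2 t\<close> leave room for the boundary of \<open>Q\<close> halfway between two radii, so that
      every ball of radius \<open>t\<close> centred off the shell \<open>S\<close> is either inside or outside \<open>Q\<close>.\<close>
    define a where "a k = measure \<mu> (X \<inter> ball y (t + 2 * real k * t))" for k
    have "m \<le> a 0" using y by (simp add: a_def Int_absorb1)
    moreover have "a N \<le> 1" by (simp add: a_def)
    ultimately obtain k where k: "k < N" "a (Suc k) \<le> (1 + \<delta>) * a k"
      using slow_growth_step[of \<delta> m a N] pos(1) N by blast
    define \<rho> where "\<rho> = t + 2 * real k * t"
    have ak: "a k = measure \<mu> (X \<inter> ball y \<rho>)"
      and ak': "a (Suc k) = measure \<mu> (X \<inter> ball y (\<rho> + 2 * t))"
      by (simp_all add: a_def \<rho>_def algebra_simps)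
    have \<rho>: "t \<le> \<rho>" using pos by (simp add: \<rho>_def)
    have "real k + 1 \<le> real N" using k(1) by simp
    then have "(real k + 1) * t \<le> real N * t" using pos by (intro mult_right_mono) auto
    then have \<rho>N: "\<rho> + t \<le> 2 * real N * t" by (simp add: \<rho>_def algebra_simps)
    define Q where "Q = X \<inter> ball y (\<rho> + t)"
    define S where "S = X \<inter> (ball y (\<rho> + 2 * t) - ball y \<rho>)"
    have [measurable]: "Q \<in> sets borel" "S \<in> sets borel" unfolding Q_def S_def by measurable
    have QX: "Q \<subseteq> X" by (auto simp: Q_def)
    have "ball y t \<subseteq> Q" using y(1) \<rho> pos by (auto simp: Q_def)
    then have mQ: "m \<le> measure \<mu> Q"
      by (intro order_trans[OF y(2)] finite_measure_mono) (auto simp: sets)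
    have S: "measure \<mu> S \<le> \<delta> * measure \<mu> Q"
    proof -
      have "S = (X \<inter> ball y (\<rho> + 2 * t)) - (X \<inter> ball y \<rho>)" by (auto simp: S_def)
      also have "measure \<mu> \<dots> = a (Suc k) - a k"
        unfolding ak ak' using pos by (intro finite_measure_Diff) auto
      also have "\<dots> \<le> \<delta> * a k" using k(2) by (simp add: algebra_simps)
      also have "a k \<le> measure \<mu> Q"
        unfolding ak Q_def using pos by (intro finite_measure_mono) auto
      then have "\<delta> * a k \<le> \<delta> * measure \<mu> Q" using pos by (intro mult_left_mono)
      finally show ?thesis .
    qed
    have "measure \<mu> (X - Q) = measure \<mu> X - measure \<mu> Q"
      using QX by (intro finite_measure_Diff) auto
    then have "measure \<mu> (X - Q) < real n * m" using mQ Suc.prems(2) by (simp add: algebra_simps)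
    then obtain \<Q> E where IH: "finite \<Q>" "\<Q> \<subseteq> sets borel" "disjoint \<Q>" "\<Union>\<Q> \<subseteq> X - Q"
        "\<And>Q u v. Q \<in> \<Q> \<Longrightarrow> u \<in> Q \<Longrightarrow> v \<in> Q \<Longrightarrow> dist u v < 4 * real N * t"
        "E \<in> sets borel" "measure \<mu> E \<le> \<delta> * measure \<mu> (\<Union>\<Q>)"
        "\<And>z. ball z t \<subseteq> X - Q \<Longrightarrow> m \<le> measure \<mu> (ball z t) \<Longrightarrow>
              z \<in> E \<or> (\<exists>Q\<in>\<Q>. ball z t \<subseteq> Q)"
      using Suc.IH[of "X - Q"] by auto
    show ?thesis
    proof (intro exI[of _ "insert Q \<Q>"] exI[of _ "S \<union> E"] conjI ballI allI impI)
      show "disjoint (insert Q \<Q>)"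
        using IH(3,4) by (auto simp: disjoint_def)
      show "\<Union>(insert Q \<Q>) \<subseteq> X" using IH(4) QX by auto
      show "measure \<mu> (S \<union> E) \<le> \<delta> * measure \<mu> (\<Union>(insert Q \<Q>))"
      proof -
        have [measurable]: "\<Union>\<Q> \<in> sets borel" "E \<in> sets borel" using IH(1,2,6) by auto
        have "measure \<mu> (S \<union> E) \<le> measure \<mu> S + measure \<mu> E"
          by (intro measure_Un_le) (auto simp: sets IH(6))
        also have "\<dots> \<le> \<delta> * (measure \<mu> Q + measure \<mu> (\<Union>\<Q>))"
          using S IH(7) by (simp add: algebra_simps)
        also have "measure \<mu> Q + measure \<mu> (\<Union>\<Q>) = measure \<mu> (\<Union>(insert Q \<Q>))"
          using IH(4) by (subst finite_measure_Union[symmetric]) auto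
        finally show ?thesis .
      qed
    next
      fix R u v assume *: "R \<in> insert Q \<Q>" "u \<in> R" "v \<in> R"
      show "dist u v < 4 * real N * t"
      proof (cases "R = Q")
        case True
        then have "dist y u < \<rho> + t" "dist y v < \<rho> + t" using * by (auto simp: Q_def)
        then show ?thesis using \<rho>N dist_triangle3[of u v y] by linarith
      qed (use * IH(5) in auto)
    next
      fix z assume z: "ball z t \<subseteq> X" "m \<le> measure \<mu> (ball z t)"
      have zX: "z \<in> X" using z(1) pos by auto
      consider "dist y z < \<rho>" | "\<rho> \<le> dist y z" "dist y z < \<rho> + 2 * t" | "\<rho> + 2 * t \<le> dist y z"
        by linarith
      then show "z \<in> S \<union> E \<or> (\<exists>Q\<in>insert Q \<Q>. ball z t \<subseteq> Q)"
      proof cases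
        case 1
        have "ball z t \<subseteq> Q"
        proof
          fix w assume w: "w \<in> ball z t"
          then have "dist y w < \<rho> + t" using 1 dist_triangle[of y w z] by auto
          then show "w \<in> Q" using z(1) w by (auto simp: Q_def)
        qed
        then show ?thesis by blast
      next
        case 2
        then show ?thesis using zX by (auto simp: S_def)
      next
        case 3
        have "ball z t \<subseteq> X - Q"
        proof
          fix w assume w: "w \<in> ball z t"
          then have "\<rho> + t < dist y w"
            using 3 dist_triangle[of y z w] by (auto simp: dist_commute)
          then show "w \<in> X - Q" using z(1) w by (auto simp: Q_def)
        qed
        then show ?thesis using IH(8)[OF _ z(2)] by blast
      qed
    qed (use IH in auto)
  qed
qed

section \<open>Returns of measure preserving maps\<close>

lemma distr_funpow_eq:
  assumes f: "f \<in> M \<rightarrow>\<^sub>M M" and inv: "distr M M f = M"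
  shows "distr M M (f ^^ j) = M"
proof (induction j)
  case 0
  show ?case using distr_id[of M] by (simp add: id_def)
next
  case (Suc j)
  have "f ^^ j \<in> M \<rightarrow>\<^sub>M M" using f by (rule measurable_compose_n)
  then have "distr M M (f ^^ Suc j) = distr (distr M M (f ^^ j)) M f"
    using f by (simp add: distr_distr)
  then show ?case unfolding Suc inv .
qed

text \<open>
  A point cannot visit the non-returning set at two times that differ by at most \<open>L\<close>. So the
  preimages of this set under the first \<open>L + 1\<close> iterates are disjoint, and they all have its
  measure.
\<close>

lemma measure_no_return_le:
  assumes "prob_space M" and f: "f \<in> M \<rightarrow>\<^sub>M M" and inv: "distr M M f = M"
    and B: "B \<in> sets M"
  shows "{z \<in> B. \<forall>j\<in>{1..L}. (f ^^ j) z \<notin> B} \<in> sets M" (is "?A \<in> _")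
    and "measure M {z \<in> B. \<forall>j\<in>{1..L}. (f ^^ j) z \<notin> B} \<le> 1 / (real L + 1)"
proof -
  interpret prob_space M by fact
  have fj: "f ^^ j \<in> M \<rightarrow>\<^sub>M M" for j
    using f by (rule measurable_compose_n)
  note [measurable] = B fj
  have "?A = {z \<in> space M. z \<in> B \<and> (\<forall>j\<in>{1..L}. (f ^^ j) z \<notin> B)}"
    using sets.sets_into_space[OF B] by auto
  also have "\<dots> \<in> sets M" by measurable
  finally show A[measurable]: "?A \<in> sets M" .
  note dj = distr_funpow_eq[OF f inv]
  define D where "D j = (f ^^ j) -` ?A \<inter> space M" for j
  have DM: "D j \<in> sets M" for j
    unfolding D_def by (rule measurable_sets[OF fj A])
  have mD: "measure M (D j) = measure M ?A" for j
    using measure_distr[OF fj[of j] A] dj[of j] by (simp add: D_def)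
  have "disjoint_family_on D {..L}"
  proof -
    have "D i \<inter> D j = {}" if "i < j" "j \<le> L" for i j
    proof (rule ccontr)
      assume "D i \<inter> D j \<noteq> {}"
      then obtain z where z: "z \<in> D i" "z \<in> D j" by auto
      have "(f ^^ j) z = (f ^^ (j - i)) ((f ^^ i) z)"
        using that by (simp flip: funpow_add[THEN fun_cong, unfolded o_def])
      moreover have "j - i \<in> {1..L}" using that by auto
      ultimately show False using z by (auto simp: D_def)
    qed
    then show ?thesis unfolding disjoint_family_on_def
      by (metis Int_commute atMost_iff linorder_neqE_nat)
  qed
  then have "measure M (\<Union>j\<in>{..L}. D j) = (\<Sum>j\<le>L. measure M (D j))"
    using DM by (intro finite_measure_finite_Union) auto
  also have "\<dots> = (real L + 1) * measure M ?A" by (simp add: mD)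
  finally have "(real L + 1) * measure M ?A \<le> 1" by (metis prob_le_1)
  then show "measure M ?A \<le> 1 / (real L + 1)" by (simp add: field_simps)
qed

section \<open>Return times at one scale\<close>

lemma skew_product_funpow:
  "(skew_product \<theta> T ^^ n) (\<omega>, x) = ((\<theta> ^^ n) \<omega>, rds_iter \<theta> T n \<omega> x)"
  by (induction n) (simp_all add: skew_product_def)

lemma measure_pair_cylinder:
  assumes "prob_space P" "prob_space \<mu>" "Q \<in> sets \<mu>"
  shows "measure (P \<Otimes>\<^sub>M \<mu>) (space P \<times> Q) = measure \<mu> Q"
proof -
  interpret P: prob_space P by fact
  interpret \<mu>: prob_space \<mu> by fact
  have "emeasure (P \<Otimes>\<^sub>M \<mu>) (space P \<times> Q) = emeasure \<mu> Q"
    using assms(3) by (subst \<mu>.emeasure_pair_measure_Times) (auto simp: P.emeasure_space_1)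
  then show ?thesis by (simp add: measure_def)
qed

text \<open>
  Half of the exceptional measure \<open>2 / K\<close> is the part not covered with padding \<open>t\<close>, the other
  half consists of the points that return late to their own member of the family. The value of
  \<open>t\<close> is the one for which \<open>K\<^sup>2\<close> growth steps produce sets of diameter less than \<open>r\<close>; that many
  steps suffice because \<open>(1 + 1 / K) ^ K \<ge> 2\<close>.
\<close>

lemma return_time_le_at_scale:
  fixes P :: "'w::metric_space measure" and \<mu> :: "'x::metric_space measure"
  assumes rds: "random_dynamical_system P \<theta> T" and st: "stationary_measure P \<theta> T \<mu>"
    and r: "0 < r" and K: "0 < K"
  defines "t \<equiv> r / (4 * (real K)\<^sup>2)"
  shows "\<exists>Bad\<in>sets (P \<Otimes>\<^sub>M \<mu>). measure (P \<Otimes>\<^sub>M \<mu>) Bad \<le> 2 / real K \<and>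
    (\<forall>\<omega> x. (\<omega>, x) \<notin> Bad \<longrightarrow> 2 / 2 ^ K \<le> measure \<mu> (ball x t) \<longrightarrow>
       ereal_of_enat (return_time \<theta> T r p \<omega> x)
         \<le> ereal (real (p + 1) * real K / measure \<mu> (ball x t)))"
proof -
  have "prob_space P" "prob_space \<mu>" and sets: "sets P = sets borel" "sets \<mu> = sets borel"
    and \<theta>[measurable]: "\<theta> \<in> P \<rightarrow>\<^sub>M P"
    and T: "(\<lambda>(\<omega>, x). T \<omega> x) \<in> borel \<Otimes>\<^sub>M borel \<rightarrow>\<^sub>M borel"
    and inv: "distr (P \<Otimes>\<^sub>M \<mu>) (P \<Otimes>\<^sub>M \<mu>) (skew_product \<theta> T) = P \<Otimes>\<^sub>M \<mu>"
    using rds st by (auto simp: random_dynamical_system_def stationary_measure_def)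
  interpret P: prob_space P by fact
  interpret \<mu>: prob_space \<mu> by fact
  let ?M = "P \<Otimes>\<^sub>M \<mu>"
  interpret M: prob_space ?M by (rule prob_space_pair) fact+
  have [simp]: "space P = UNIV" "space \<mu> = UNIV"
    using sets_eq_imp_space_eq[OF sets(1)] sets_eq_imp_space_eq[OF sets(2)] by simp_all
  have "sets ?M = sets (borel \<Otimes>\<^sub>M borel)" using sets by (rule sets_pair_measure_cong)
  then have T'[measurable]: "(\<lambda>(\<omega>, x). T \<omega> x) \<in> ?M \<rightarrow>\<^sub>M \<mu>"
    using T measurable_cong_sets[OF _ sets(2)] by blast
  have S: "skew_product \<theta> T \<in> ?M \<rightarrow>\<^sub>M ?M"
    unfolding skew_product_def by measurable
  let ?F = "skew_product \<theta> T ^^ (p + 1)"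
  have F: "?F \<in> ?M \<rightarrow>\<^sub>M ?M" using S by (rule measurable_compose_n)
  have F_inv: "distr ?M ?M ?F = ?M"
    using S inv by (rule distr_funpow_eq)

  have t: "0 < t" using r K by (simp add: t_def)
  have "2 \<le> (1 + 1 / real K) ^ K"
    using Bernoulli_inequality[of "1 / real K" K] K order_trans[of "-1" 0 "1 / real K"] by simp
  then have "2 ^ K \<le> ((1 + 1 / real K) ^ K) ^ K" by (rule power_mono) simp
  then have "2 ^ K < 2 * ((1 + 1 / real K) ^ K) ^ K"
    using zero_less_power[of "2::real" K] by linarith
  then have "1 < 2 / 2 ^ K * (1 + 1 / real K) ^ (K\<^sup>2)"
    by (simp add: power2_eq_square power_mult field_simps)
  moreover obtain n where "1 < real n * (2 / 2 ^ K)"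
    using reals_Archimedean3[of "2 / 2 ^ K :: real"]
    by (meson zero_less_divide_iff zero_less_numeral zero_less_power)
  then have "measure \<mu> UNIV < real n * (2 / 2 ^ K)"
    using \<mu>.prob_le_1[of UNIV] by linarith
  ultimately obtain \<Q> E where \<Q>: "finite \<Q>" "\<Q> \<subseteq> sets borel" "disjoint \<Q>"
      "\<And>Q u v. Q \<in> \<Q> \<Longrightarrow> u \<in> Q \<Longrightarrow> v \<in> Q \<Longrightarrow> dist u v < 4 * real (K\<^sup>2) * t"
    and E: "E \<in> sets borel" "measure \<mu> E \<le> 1 / real K * measure \<mu> (\<Union>\<Q>)"
    and pad: "\<And>z. 2 / 2 ^ K \<le> measure \<mu> (ball z t) \<Longrightarrow> z \<in> E \<or> (\<exists>Q\<in>\<Q>. ball z t \<subseteq> Q)"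
    using padded_family_within[OF \<open>prob_space \<mu>\<close> sets(2), of "1 / real K" t "2 / 2 ^ K" "K\<^sup>2" UNIV n] t
    by auto
  have diam: "dist u v < r" if "Q \<in> \<Q>" "u \<in> Q" "v \<in> Q" for Q u v
    using \<Q>(4)[OF that] K by (simp add: t_def)
  \<comment> \<open>Null sets are dropped: for them \<open>K / \<mu>(Q)\<close> would be \<open>0\<close> by the convention on division.\<close>
  define \<Q>' where "\<Q>' = {Q \<in> \<Q>. 0 < measure \<mu> Q}"
  have \<Q>': "finite \<Q>'" "\<Q>' \<subseteq> sets \<mu>" "disjoint \<Q>'"
    using \<Q> pairwise_subset[OF \<Q>(3), of \<Q>'] by (auto simp: \<Q>'_def sets)
  define L where "L Q = nat \<lfloor>real K / measure \<mu> Q\<rfloor>" for Q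
  define A where "A Q = {z \<in> UNIV \<times> Q. \<forall>j\<in>{1..L Q}. (?F ^^ j) z \<notin> UNIV \<times> Q}" for Q
  define Bad where "Bad = (UNIV \<times> E) \<union> (\<Union>Q\<in>\<Q>'. A Q)"
  have cyl: "UNIV \<times> Q \<in> sets ?M" if "Q \<in> sets \<mu>" for Q
    using pair_measureI[OF sets.top[of P] that] by simp
  have A: "A Q \<in> sets ?M" "measure ?M (A Q) \<le> measure \<mu> Q / real K" if "Q \<in> \<Q>'" for Q
  proof -
    have Q: "UNIV \<times> Q \<in> sets ?M" "0 < measure \<mu> Q"
      using cyl that \<Q>'(2) by (auto simp: \<Q>'_def)
    note no_return = measure_no_return_le[OF M.prob_space_axioms F F_inv Q(1), of "L Q", folded A_def]
    show "A Q \<in> sets ?M" by (rule no_return(1))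
    have "real K / measure \<mu> Q \<le> real (L Q) + 1"
      unfolding L_def by linarith
    then have "1 / (real (L Q) + 1) \<le> 1 / (real K / measure \<mu> Q)"
      using Q(2) K by (intro divide_left_mono) auto
    with no_return(2) show "measure ?M (A Q) \<le> measure \<mu> Q / real K"
      by simp
  qed
  have "measure ?M Bad \<le> 2 / real K"
  proof -
    have "measure ?M Bad \<le> measure ?M (UNIV \<times> E) + measure ?M (\<Union>Q\<in>\<Q>'. A Q)"
      unfolding Bad_def using E(1) A(1) \<Q>'(1) cyl by (intro measure_Un_le) (auto simp: sets)
    moreover have "measure ?M (UNIV \<times> E) \<le> 1 / real K"
    proof -
      have "measure ?M (UNIV \<times> E) = measure \<mu> E"
        using measure_pair_cylinder[OF \<open>prob_space P\<close> \<open>prob_space \<mu>\<close>, of E] E(1) by (simp add: sets)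
      also have "\<dots> \<le> 1 / real K * measure \<mu> (\<Union>\<Q>)" by (rule E(2))
      also have "\<dots> \<le> 1 / real K" using \<mu>.prob_le_1 by (simp add: divide_right_mono)
      finally show ?thesis .
    qed
    moreover have "measure ?M (\<Union>Q\<in>\<Q>'. A Q) \<le> 1 / real K"
    proof -
      have "measure ?M (\<Union>Q\<in>\<Q>'. A Q) \<le> (\<Sum>Q\<in>\<Q>'. measure ?M (A Q))"
        using \<Q>'(1) A(1) by (intro M.finite_measure_subadditive_finite) auto
      also have "\<dots> \<le> (\<Sum>Q\<in>\<Q>'. measure \<mu> Q / real K)" by (intro sum_mono A(2))
      also have "\<dots> = measure \<mu> (\<Union>Q\<in>\<Q>'. Q) / real K"
        using \<Q>' by (subst \<mu>.finite_measure_finite_Union)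
          (auto simp: sum_divide_distrib disjoint_family_on_disjoint_image disjoint_def disjoint_family_on_def)
      also have "\<dots> \<le> 1 / real K" using \<mu>.prob_le_1 by (simp add: divide_right_mono)
      finally show ?thesis .
    qed
    ultimately show ?thesis by simp
  qed
  moreover have "Bad \<in> sets ?M"
    unfolding Bad_def using E(1) A(1) \<Q>'(1)
    by (intro sets.Un sets.finite_UN cyl) (auto simp: sets)
  moreover have "ereal_of_enat (return_time \<theta> T r p \<omega> x)
         \<le> ereal (real (p + 1) * real K / measure \<mu> (ball x t))"
    if good: "(\<omega>, x) \<notin> Bad" and m: "2 / 2 ^ K \<le> measure \<mu> (ball x t)" for \<omega> x
  proof -
    have "x \<notin> E" using good by (auto simp: Bad_def)
    then obtain Q where Q: "Q \<in> \<Q>" "ball x t \<subseteq> Q" using pad[OF m] by blast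
    have "Q \<in> sets \<mu>" using Q \<Q>(2) by (auto simp: sets)
    then have le: "measure \<mu> (ball x t) \<le> measure \<mu> Q"
      using Q by (intro \<mu>.finite_measure_mono)
    have pos: "0 < measure \<mu> (ball x t)" using m by (rule less_le_trans[rotated]) simp
    then have "Q \<in> \<Q>'" using Q le by (simp add: \<Q>'_def)
    moreover have xQ: "x \<in> Q" using Q t by auto
    ultimately obtain j where j: "j \<in> {1..L Q}" "(?F ^^ j) (\<omega>, x) \<in> UNIV \<times> Q"
      using good by (auto simp: Bad_def A_def)
    let ?k = "(p + 1) * j"
    have "rds_iter \<theta> T ?k \<omega> x \<in> Q"
      using j(2) by (simp only: funpow_mult skew_product_funpow) simp
    then have "dist (rds_iter \<theta> T ?k \<omega> x) x < r" using diam Q xQ by blast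
    moreover have "p < ?k" using j(1) by (cases j) auto
    ultimately have "return_time \<theta> T r p \<omega> x \<le> enat ?k"
      unfolding return_time_def by (intro Inf_lower) blast
    then have "ereal_of_enat (return_time \<theta> T r p \<omega> x) \<le> ereal (real ?k)"
      by (metis ereal_of_enat_le_iff ereal_of_enat_simps(1))
    also have "real ?k \<le> real (p + 1) * (real K / measure \<mu> Q)"
    proof -
      have "real j \<le> real K / measure \<mu> Q" using j(1) by (simp add: L_def) linarith
      then show ?thesis unfolding of_nat_mult by (intro mult_left_mono) auto
    qed
    also have "\<dots> \<le> real (p + 1) * (real K / measure \<mu> (ball x t))"
      using le pos by (intro mult_left_mono divide_left_mono) auto
    finally show ?thesis by simp
  qed
  ultimately show ?thesis by blast
qed

section \<open>Almost sure bounds along dyadic scales\<close>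

text \<open>The \<open>t\<close> belonging to \<open>r = 1 / 2 ^ n\<close> and \<open>K = (n + 1)\<^sup>2\<close>.\<close>

definition padding_radius :: "nat \<Rightarrow> real" where
  "padding_radius n = (1 / 2 ^ n) / (4 * (real ((n + 1)\<^sup>2))\<^sup>2)"

lemma AE_eventually_return_time_le:
  fixes P :: "'w::metric_space measure" and \<mu> :: "'x::metric_space measure"
  assumes rds: "random_dynamical_system P \<theta> T" and st: "stationary_measure P \<theta> T \<mu>"
  shows "AE (\<omega>, x) in P \<Otimes>\<^sub>M \<mu>. \<forall>p. \<forall>\<^sub>F n in sequentially.
    2 / 2 ^ ((n + 1)\<^sup>2) \<le> measure \<mu> (ball x (padding_radius n)) \<longrightarrow>
       ereal_of_enat (return_time \<theta> T (1 / 2 ^ n) p \<omega> x)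
         \<le> ereal (real (p + 1) * real ((n + 1)\<^sup>2) / measure \<mu> (ball x (padding_radius n)))"
proof -
  let ?M = "P \<Otimes>\<^sub>M \<mu>"
  interpret M: prob_space ?M
    using rds st by (intro prob_space_pair)
      (auto simp: random_dynamical_system_def stationary_measure_def)
  let ?good = "\<lambda>p n \<omega> x. 2 / 2 ^ ((n + 1)\<^sup>2) \<le> measure \<mu> (ball x (padding_radius n)) \<longrightarrow>
       ereal_of_enat (return_time \<theta> T (1 / 2 ^ n) p \<omega> x)
         \<le> ereal (real (p + 1) * real ((n + 1)\<^sup>2) / measure \<mu> (ball x (padding_radius n)))"
  have "AE z in ?M. \<forall>\<^sub>F n in sequentially. ?good p n (fst z) (snd z)" for p
  proof -
    have "\<exists>Bad\<in>sets ?M. measure ?M Bad \<le> 2 / real ((n + 1)\<^sup>2) \<and>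
        (\<forall>\<omega> x. (\<omega>, x) \<notin> Bad \<longrightarrow> ?good p n \<omega> x)" for n
      unfolding padding_radius_def by (rule return_time_le_at_scale[OF rds st]) simp_all
    then obtain Bad where Bad: "\<And>n. Bad n \<in> sets ?M"
        "\<And>n. measure ?M (Bad n) \<le> 2 / real ((n + 1)\<^sup>2)"
        "\<And>n \<omega> x. (\<omega>, x) \<notin> Bad n \<Longrightarrow> ?good p n \<omega> x"
      by metis
    have "summable (\<lambda>n. 2 * (1 / real ((n + 1)\<^sup>2)))"
      using inverse_squares_sums by (intro summable_mult) (auto simp: sums_iff add.commute)
    then have "summable (\<lambda>n. measure ?M (Bad n))"
      by (rule summable_comparison_test'[where N = 0]) (use Bad(2) in auto)
    then have "AE z in ?M. \<forall>\<^sub>F n in sequentially. z \<in> space ?M - Bad n"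
      using Bad(1) by (intro borel_cantelli_AE1) (auto simp: less_top[symmetric])
    then show ?thesis
    proof eventually_elim
      case (elim z)
      then show ?case by eventually_elim (use Bad(3)[of "fst z" "snd z"] in auto)
    qed
  qed
  then show ?thesis by (simp add: AE_all_countable case_prod_beta')
qed

section \<open>Comparing exponents\<close>

lemma decreasing_sequence_bracket:
  fixes u :: "nat \<Rightarrow> real"
  assumes "u \<longlonglongrightarrow> 0" "0 < s" "s \<le> u N"
  obtains n where "N \<le> n" "u (Suc n) < s" "s \<le> u n"
proof -
  have "\<forall>\<^sub>F n in sequentially. u n < s"
    using assms(1,2) by (rule order_tendstoD)
  then obtain M where M: "\<And>n. n \<ge> M \<Longrightarrow> u n < s"
    by (auto simp: eventually_sequentially)
  define k where "k = (LEAST k. N \<le> k \<and> u (Suc k) < s)"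
  have ex: "N \<le> max N M \<and> u (Suc (max N M)) < s"
    using M[of "Suc (max N M)"] by auto
  have k: "N \<le> k" "u (Suc k) < s"
    using LeastI[of "\<lambda>k. N \<le> k \<and> u (Suc k) < s", OF ex] by (auto simp: k_def)
  have "s \<le> u k"
  proof (cases "k = N")
    case False
    then obtain j where j: "k = Suc j" "N \<le> j"
      using k(1) by (cases k) auto
    have "\<not> (N \<le> j \<and> u (Suc j) < s)"
      using not_less_Least[of j "\<lambda>k. N \<le> k \<and> u (Suc k) < s"] j by (simp add: k_def)
    then show ?thesis using j by auto
  qed (use assms in simp)
  with k that show ?thesis by blast
qed

text \<open>
  The hypothesis forces \<open>m > 0\<close>: otherwise the quotient is \<open>(-\<infinity>) / (ln s) = \<infinity>\<close>.
\<close>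

lemma local_dim_quotient_less:
  assumes "0 < s" "s < 1" "elog (ereal m) / ereal (ln s) < ereal c"
  shows "s powr c \<le> m"
proof -
  have s: "ln s < 0" using assms by simp
  have m: "0 < m"
  proof (rule ccontr)
    assume "\<not> 0 < m"
    then have "elog (ereal m) / ereal (ln s) = \<infinity>"
      using s by (simp add: elog_def divide_ereal_def)
    then show False using assms(3) by simp
  qed
  then have "ln m / ln s < c"
    using assms(3) s by (simp add: elog_def)
  then have "c * ln s < ln m" using s by (simp add: neg_divide_less_eq)
  then show ?thesis
    using assms(1) m by (simp add: powr_def flip: ln_ge_iff)
qed

lemma local_dim_quotient_nonneg:
  assumes "0 < s" "s < 1" "m \<le> 1"
  shows "0 \<le> elog (ereal m) / ereal (ln s)"
  using assms by (auto simp: elog_def divide_ereal_def zero_le_mult_iff)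

lemma recurrence_quotient_le:
  assumes \<tau>: "1 \<le> \<tau>" "ereal_of_enat \<tau> \<le> ereal B" and q: "0 < q" "q \<le> - ln r"
  shows "elog (ereal_of_enat \<tau>) / ereal (- ln r) \<le> ereal (ln B / q)"
proof -
  obtain k where k: "\<tau> = enat k" using \<tau>(2) by (cases \<tau>) auto
  have "1 \<le> real k" using \<tau>(1) k by (simp add: one_enat_def)
  have "ln (real k) / (- ln r) \<le> ln (real k) / q"
    using q \<open>1 \<le> real k\<close> by (intro divide_left_mono mult_pos_pos) auto
  also have "\<dots> \<le> ln B / q"
    using q \<tau>(2) k \<open>1 \<le> real k\<close> by (intro divide_right_mono) auto
  finally show ?thesis
    using q k \<open>1 \<le> real k\<close> by (simp add: elog_def)
qed

lemma padding_radius_pos: "0 < padding_radius n"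
  by (simp add: padding_radius_def)

lemma padding_radius_decreasing: "padding_radius (Suc n) \<le> padding_radius n"
  unfolding padding_radius_def
  by (intro frac_le mult_left_mono power_mono divide_left_mono) (auto simp: power_increasing)

lemma padding_radius_tendsto_0: "padding_radius \<longlonglongrightarrow> 0"
  unfolding padding_radius_def by real_asymp

lemma ln_padding_radius:
  "ln (padding_radius n) = - (real n * ln 2 + ln 4 + 4 * ln (real n + 1))"
  by (simp add: padding_radius_def ln_div ln_mult ln_realpow add_ac)

lemma eventually_padding_radius_powr_ge:
  "\<forall>\<^sub>F n in sequentially. 2 / 2 ^ ((n + 1)\<^sup>2) \<le> padding_radius (Suc n) powr c"
proof -
  have "\<forall>\<^sub>F n in sequentially. ln 2 - real ((n + 1)\<^sup>2) * ln 2 \<le>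
     - c * (real (Suc n) * ln 2 + ln 4 + 4 * ln (real (Suc n) + 1))"
    by real_asymp
  then show ?thesis
  proof eventually_elim
    case (elim n)
    then have "ln (2 / 2 ^ ((n + 1)\<^sup>2)) \<le> ln (padding_radius (Suc n) powr c)"
      using padding_radius_pos[of "Suc n"]
      by (simp add: ln_padding_radius ln_div ln_realpow ln_powr algebra_simps)
    then show ?case using padding_radius_pos[of "Suc n"] by (subst (asm) ln_le_cancel_iff) auto
  qed
qed

text \<open>
  The index shift in \<open>padding_radius (Suc n)\<close> serves the lower limit: a radius \<open>s\<close> there is only
  located between two consecutive padding radii, so the power \<open>s powr c\<close> has to be replaced by
  that of the smaller one.
\<close>

lemma eventually_time_exponent_le:
  assumes "0 < C" "c < c'"
  shows "\<forall>\<^sub>F n in sequentially.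
    ln (C * real ((n + 1)\<^sup>2) / padding_radius (Suc n) powr c) / ((real n - 1) * ln 2) \<le> c'"
proof -
  have "(\<lambda>n. (ln C + 2 * ln (real n + 1) + c * (real (Suc n) * ln 2 + ln 4 + 4 * ln (real (Suc n) + 1)))
           / ((real n - 1) * ln 2)) \<longlonglongrightarrow> c"
    by real_asymp
  then have "\<forall>\<^sub>F n in sequentially.
     (ln C + 2 * ln (real n + 1) + c * (real (Suc n) * ln 2 + ln 4 + 4 * ln (real (Suc n) + 1)))
           / ((real n - 1) * ln 2) < c'"
    using assms(2) by (rule order_tendstoD)
  then show ?thesis
  proof eventually_elim
    case (elim n)
    have "ln (C * real ((n + 1)\<^sup>2) / padding_radius (Suc n) powr c) =
       ln C + 2 * ln (real n + 1) + c * (real (Suc n) * ln 2 + ln 4 + 4 * ln (real (Suc n) + 1))"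
      using assms(1) padding_radius_pos[of "Suc n"]
      by (simp add: ln_div ln_mult ln_powr ln_padding_radius ln_realpow algebra_simps)
    then show ?case using elim by simp
  qed
qed

text \<open>
  In this context the point \<open>(\<omega>, x)\<close> and the delay \<open>p\<close> are fixed: \<open>m r\<close> stands for the mass of
  the ball of radius \<open>r\<close>, \<open>\<tau> r\<close> for the return time and \<open>C\<close> for \<open>p + 1\<close>.
\<close>

context
  fixes m :: "real \<Rightarrow> real" and \<tau> :: "real \<Rightarrow> enat" and C :: real
  assumes m_mono: "\<And>r s. r \<le> s \<Longrightarrow> m r \<le> m s" and m_le_1: "\<And>r. m r \<le> 1"
    and \<tau>_antimono: "\<And>r s. r \<le> s \<Longrightarrow> \<tau> s \<le> \<tau> r" and \<tau>_ge_1: "\<And>r. 1 \<le> \<tau> r"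
    and C: "0 < C"
    and bound: "\<forall>\<^sub>F n in sequentially. 2 / 2 ^ ((n + 1)\<^sup>2) \<le> m (padding_radius n) \<longrightarrow>
       ereal_of_enat (\<tau> (1 / 2 ^ n)) \<le> ereal (C * real ((n + 1)\<^sup>2) / m (padding_radius n))"
begin

abbreviation recurrence_quotient :: "real \<Rightarrow> ereal" where
  "recurrence_quotient r \<equiv> elog (ereal_of_enat (\<tau> r)) / ereal (- ln r)"

abbreviation dimension_quotient :: "real \<Rightarrow> ereal" where
  "dimension_quotient r \<equiv> elog (ereal (m r)) / ereal (ln r)"

lemma eventually_recurrence_quotient_le:
  assumes "c < c'"
  shows "\<forall>\<^sub>F n in sequentially. padding_radius (Suc n) powr c \<le> m (padding_radius n) \<longrightarrow>
    (\<forall>r. 1 / 2 ^ n \<le> r \<longrightarrow> r \<le> 2 / 2 ^ n \<longrightarrow> recurrence_quotient r \<le> ereal c')"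
  using bound eventually_padding_radius_powr_ge[of c] eventually_time_exponent_le[OF C assms]
    eventually_ge_at_top[of 2]
proof eventually_elim
  case (elim n)
  show ?case
  proof (intro impI allI)
    fix r :: real assume mass: "padding_radius (Suc n) powr c \<le> m (padding_radius n)"
      and r: "1 / 2 ^ n \<le> r" "r \<le> 2 / 2 ^ n"
    define B where "B = C * real ((n + 1)\<^sup>2) / padding_radius (Suc n) powr c"
    have pos: "0 < padding_radius (Suc n) powr c"
      using padding_radius_pos[of "Suc n"] by simp
    have "ereal_of_enat (\<tau> r) \<le> ereal_of_enat (\<tau> (1 / 2 ^ n))"
      using \<tau>_antimono[OF r(1)] by simp
    also have "\<dots> \<le> ereal (C * real ((n + 1)\<^sup>2) / m (padding_radius n))"
      using elim(1,2) mass by linarith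
    also have "\<dots> \<le> ereal B"
      unfolding B_def ereal_less_eq using mass pos less_le_trans[OF pos mass] C
        by (intro divide_left_mono mult_pos_pos) auto
    finally have "ereal_of_enat (\<tau> r) \<le> ereal B" .
    moreover have "0 < (real n - 1) * ln 2" using elim(4) by simp
    moreover have "(real n - 1) * ln 2 \<le> - ln r"
    proof -
      have "0 < r" using r(1) by (rule less_le_trans[rotated]) simp
      then have "ln r \<le> ln (2 / 2 ^ n)" using r(2) by simp
      then show ?thesis by (simp add: ln_div ln_realpow algebra_simps)
    qed
    ultimately have "recurrence_quotient r \<le> ereal (ln B / ((real n - 1) * ln 2))"
      using \<tau>_ge_1 by (intro recurrence_quotient_le)
    also have "\<dots> \<le> ereal c'" using elim(3) by (simp add: B_def)
    finally show "recurrence_quotient r \<le> ereal c'" .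
  qed
qed

lemma eventually_dimension_quotient_nonneg: "\<forall>\<^sub>F r in at_right 0. 0 \<le> dimension_quotient r"
  using eventually_at_right_real[of 0 1]
  by (auto elim!: eventually_mono intro!: local_dim_quotient_nonneg m_le_1)

text \<open>
  An upper local dimension below \<open>c\<close> bounds the mass from below at every small radius, hence the
  recurrence quotient on every dyadic interval, and these intervals exhaust a right neighbourhood
  of \<open>0\<close>.
\<close>

lemma Limsup_recurrence_quotient_le:
  "Limsup (at_right 0) recurrence_quotient \<le> Limsup (at_right 0) dimension_quotient"
proof (rule dense_ge)
  fix w assume "Limsup (at_right 0) dimension_quotient < w"
  then obtain c where c: "Limsup (at_right 0) dimension_quotient < ereal c" "ereal c < w"
    by (meson ereal_dense2)
  then obtain c' where c': "c < c'" "ereal c' < w"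
    using ereal_dense2[of "ereal c" w] by auto
  have "0 \<le> Limsup (at_right 0) dimension_quotient"
    using eventually_dimension_quotient_nonneg
    by (intro order_trans[OF Liminf_bounded Liminf_le_Limsup]) auto
  then have "0 < c" using c(1) by (simp add: zero_ereal_def) (metis ereal_less(2) le_less_trans zero_ereal_def)
  have "\<forall>\<^sub>F s in at_right 0. dimension_quotient s < ereal c"
    using c(1) by (rule Limsup_lessD)
  then have "\<forall>\<^sub>F s in at_right 0. s powr c \<le> m s"
    using eventually_at_right_real[of 0 1, OF zero_less_one]
    by eventually_elim (auto intro: local_dim_quotient_less)
  moreover have "filterlim padding_radius (at_right 0) sequentially"
    using padding_radius_tendsto_0 padding_radius_pos by (simp add: tendsto_imp_filterlim_at_right)
  ultimately have "\<forall>\<^sub>F n in sequentially. padding_radius n powr c \<le> m (padding_radius n)"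
    by (rule eventually_compose_filterlim)
  then have "\<forall>\<^sub>F n in sequentially. \<forall>r. 1 / 2 ^ n \<le> r \<longrightarrow> r \<le> 2 / 2 ^ n \<longrightarrow> recurrence_quotient r \<le> ereal c'"
    using eventually_recurrence_quotient_le[OF c'(1)]
  proof eventually_elim
    case (elim n)
    have "padding_radius (Suc n) powr c \<le> padding_radius n powr c"
      using \<open>0 < c\<close> padding_radius_pos[of "Suc n"] padding_radius_decreasing[of n]
      by (intro powr_mono2) auto
    then show ?case using elim by auto
  qed
  then obtain N where N: "\<And>n r. n \<ge> N \<Longrightarrow> 1 / 2 ^ n \<le> r \<Longrightarrow> r \<le> 2 / 2 ^ n \<Longrightarrow> recurrence_quotient r \<le> ereal c'"
    by (auto simp: eventually_sequentially)
  have "\<forall>\<^sub>F r in at_right 0. recurrence_quotient r \<le> ereal c'"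
    using eventually_at_right_real[of 0 "1 / 2 ^ N"]
  proof (rule eventually_mono)
    fix r :: real assume "r \<in> {0<..<1 / 2 ^ N}"
    moreover have "(\<lambda>n. 1 / 2 ^ n :: real) \<longlonglongrightarrow> 0" by real_asymp
    ultimately obtain n where "N \<le> n" "1 / 2 ^ Suc n < r" "r \<le> 1 / 2 ^ n"
      using decreasing_sequence_bracket[of "\<lambda>n. 1 / 2 ^ n" r N] by auto
    then show "recurrence_quotient r \<le> ereal c'"
      by (intro N[of "Suc n"]) auto
  qed simp
  then have "Limsup (at_right 0) recurrence_quotient \<le> ereal c'" by (rule Limsup_bounded)
  then show "Limsup (at_right 0) recurrence_quotient \<le> w" using c'(2) by simp
qed

text \<open>
  Here the mass bound holds only along some radii \<open>s\<close> tending to \<open>0\<close>. If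
  \<open>padding_radius (Suc n) < s \<le> padding_radius n\<close>, monotonicity carries it over to
  \<open>padding_radius n\<close>, so the return time is small at \<open>1 / 2 ^ n\<close> for infinitely many \<open>n\<close>. The
  proof runs through the contrapositive.
\<close>

lemma Liminf_recurrence_quotient_le:
  "Liminf (at_right 0) recurrence_quotient \<le> Liminf (at_right 0) dimension_quotient"
proof (rule dense_ge)
  fix w assume "Liminf (at_right 0) dimension_quotient < w"
  then obtain c where c: "Liminf (at_right 0) dimension_quotient < ereal c" "ereal c < w"
    by (meson ereal_dense2)
  then obtain c' where c': "c < c'" "ereal c' < w"
    using ereal_dense2[of "ereal c" w] by auto
  have "0 \<le> Liminf (at_right 0) dimension_quotient"
    using eventually_dimension_quotient_nonneg by (rule Liminf_bounded)
  then have "0 < c" using c(1) by (simp add: zero_ereal_def) (metis ereal_less(2) le_less_trans zero_ereal_def)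
  show "Liminf (at_right 0) recurrence_quotient \<le> w"
  proof (rule ccontr)
    assume "\<not> ?thesis"
    then have "ereal c' < Liminf (at_right 0) recurrence_quotient" using c'(2) by simp
    then have "\<forall>\<^sub>F r in at_right 0. ereal c' < recurrence_quotient r" by (rule less_LiminfD)
    moreover have "filterlim (\<lambda>n. 1 / 2 ^ n :: real) (at_right 0) sequentially"
      by real_asymp
    ultimately have "\<forall>\<^sub>F n in sequentially. ereal c' < recurrence_quotient (1 / 2 ^ n)"
      by (rule eventually_compose_filterlim)
    then have "\<forall>\<^sub>F n in sequentially. m (padding_radius n) < padding_radius (Suc n) powr c"
      using eventually_recurrence_quotient_le[OF c'(1)]
    proof eventually_elim
      case (elim n)
      then show ?case by (meson divide_right_mono not_le one_le_numeral order_refl zero_le_numeral zero_le_power)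
    qed
    then obtain N where N: "\<And>n. n \<ge> N \<Longrightarrow> m (padding_radius n) < padding_radius (Suc n) powr c"
      by (auto simp: eventually_sequentially)
    define b where "b = min 1 (padding_radius N)"
    have "0 < b" using padding_radius_pos by (simp add: b_def)
    then have "\<forall>\<^sub>F s in at_right 0. s \<in> {0<..<b}" by (rule eventually_at_right_real)
    then have "\<forall>\<^sub>F s in at_right 0. ereal c \<le> dimension_quotient s"
    proof (rule eventually_mono)
      fix s assume s: "s \<in> {0<..<b}"
      then obtain n where n: "N \<le> n" "padding_radius (Suc n) < s" "s \<le> padding_radius n"
        using decreasing_sequence_bracket[OF padding_radius_tendsto_0, of s N] by (auto simp: b_def)
      have "m s \<le> m (padding_radius n)" using n(3) by (rule m_mono)
      also have "\<dots> < padding_radius (Suc n) powr c" using n(1) by (rule N)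
      also have "\<dots> \<le> s powr c"
        using n(2) padding_radius_pos[of "Suc n"] \<open>0 < c\<close> by (intro powr_mono2) auto
      finally have "\<not> s powr c \<le> m s" by simp
      moreover have "0 < s" "s < 1" using s by (auto simp: b_def)
      ultimately show "ereal c \<le> dimension_quotient s"
        using local_dim_quotient_less[of s "m s" c] not_le by blast
    qed
    then have "ereal c \<le> Liminf (at_right 0) dimension_quotient" by (rule Liminf_bounded)
    then show False using c(1) by simp
  qed
qed

end

section \<open>Recurrence rates and local dimensions\<close>

lemma return_time_antimono_radius:
  "r \<le> s \<Longrightarrow> return_time \<theta> T s p \<omega> x \<le> return_time \<theta> T r p \<omega> x"
  unfolding return_time_def by (intro Inf_superset_mono) auto

lemma return_time_mono_delay:
  "p \<le> q \<Longrightarrow> return_time \<theta> T r p \<omega> x \<le> return_time \<theta> T r q \<omega> x"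
  unfolding return_time_def by (intro Inf_superset_mono) auto

lemma one_le_return_time: "1 \<le> return_time \<theta> T r p \<omega> x"
  unfolding return_time_def by (intro Inf_greatest) (auto simp: one_enat_def)

lemma elog_mono: "a \<le> b \<Longrightarrow> elog a \<le> elog b"
  by (cases a; cases b) (auto simp: elog_def)

text \<open>Monotonicity in the delay makes the limit over \<open>p\<close> in the recurrence rates exist.\<close>

lemma recurrence_quotient_mono_delay:
  assumes "r \<in> {0<..<1}" "p \<le> q"
  shows "elog (ereal_of_enat (return_time \<theta> T r p \<omega> x)) / ereal (- ln r)
     \<le> elog (ereal_of_enat (return_time \<theta> T r q \<omega> x)) / ereal (- ln r)"
  using assms
  by (intro ereal_divide_right_mono elog_mono) (auto simp: return_time_mono_delay)

lemma lim_incseq_le: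
  fixes X :: "nat \<Rightarrow> ereal"
  assumes "incseq X" "\<And>p. X p \<le> d"
  shows "lim X \<le> d"
  using assms by (simp add: limI[OF LIMSEQ_SUP] SUP_le_iff)

theorem theorem7:
  fixes A :: "('x::metric_space, 'e::euclidean_space) chart set"
    and g :: "('x, 'e) chart \<Rightarrow> 'x \<Rightarrow> 'e \<Rightarrow> 'e \<Rightarrow> real"
    and P :: "'w::metric_space measure"
    and \<theta> :: "'w \<Rightarrow> 'w"
    and T :: "'w \<Rightarrow> 'x \<Rightarrow> 'x"
    and \<mu> :: "'x measure"
  assumes "riemannian_manifold A g"
    and "compact (UNIV :: 'x set)"
    and "random_dynamical_system P \<theta> T"
    and "stationary_measure P \<theta> T \<mu>"
  shows "AE (\<omega>, x) in P \<Otimes>\<^sub>M \<mu>.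
           lower_recurrence_rate \<theta> T \<omega> x \<le> lower_local_dim \<mu> x \<and>
           upper_recurrence_rate \<theta> T \<omega> x \<le> upper_local_dim \<mu> x"
proof -
  interpret \<mu>: prob_space \<mu> using assms(4) by (simp add: stationary_measure_def)
  have ball: "ball x r \<in> sets \<mu>" for x :: 'x and r
    using assms(4) by (simp add: stationary_measure_def)
  have rates: "lower_recurrence_rate \<theta> T \<omega> x \<le> lower_local_dim \<mu> x \<and>
      upper_recurrence_rate \<theta> T \<omega> x \<le> upper_local_dim \<mu> x"
    if bound: "\<forall>p. \<forall>\<^sub>F n in sequentially.
      2 / 2 ^ ((n + 1)\<^sup>2) \<le> measure \<mu> (ball x (padding_radius n)) \<longrightarrow>
       ereal_of_enat (return_time \<theta> T (1 / 2 ^ n) p \<omega> x)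
         \<le> ereal (real (p + 1) * real ((n + 1)\<^sup>2) / measure \<mu> (ball x (padding_radius n)))" for \<omega> x
  proof
    have mono: "measure \<mu> (ball x r) \<le> measure \<mu> (ball x s)" if "r \<le> s" for r s
      using that ball by (intro \<mu>.finite_measure_mono subset_ball)
    have ev01: "\<forall>\<^sub>F r in at_right 0. r \<in> {0<..<1::real}"
      by (rule eventually_at_right_real) simp
    note quotient_le = mono \<mu>.prob_le_1 return_time_antimono_radius one_le_return_time _ bound[rule_format]
    show "lower_recurrence_rate \<theta> T \<omega> x \<le> lower_local_dim \<mu> x"
      unfolding lower_recurrence_rate_def lower_local_dim_def
    proof (rule lim_incseq_le)
      show "incseq (\<lambda>p. Liminf (at_right 0)
          (\<lambda>r. elog (ereal_of_enat (return_time \<theta> T r p \<omega> x)) / ereal (- ln r)))"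
        by (intro incseq_SucI Liminf_mono eventually_mono[OF ev01] recurrence_quotient_mono_delay) auto
    qed (rule Liminf_recurrence_quotient_le[OF quotient_le], auto)
    show "upper_recurrence_rate \<theta> T \<omega> x \<le> upper_local_dim \<mu> x"
      unfolding upper_recurrence_rate_def upper_local_dim_def
    proof (rule lim_incseq_le)
      show "incseq (\<lambda>p. Limsup (at_right 0)
          (\<lambda>r. elog (ereal_of_enat (return_time \<theta> T r p \<omega> x)) / ereal (- ln r)))"
        by (intro incseq_SucI Limsup_mono eventually_mono[OF ev01] recurrence_quotient_mono_delay) auto
    qed (rule Limsup_recurrence_quotient_le[OF quotient_le], auto)
  qed
  show ?thesis
    using AE_eventually_return_time_le[OF assms(3,4)]
    by eventually_elim (use rates in auto)
qed

end
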